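(* For every positive integer $d$, $\mathcal{NB}_d \subset \mathcal{GB}_d \subset \mathcal{P}_d$, where these sets of real polynomials of degree at most $d$ are defined in the context.
   Context: Let $\mathbb{R}_d[x]$ be the space of real univariate polynomials of degree at most $d$. The degree $d$ Bernstein polynomials are $b_i(x)=\binom{d}{i}x^i(1-x)^{d-i}$, $0\le i\le d$; they form a basis of $\mathbb{R}_d[x]$, and the Bernstein coefficients of $p\in\mathbb{R}_d[x]$ are the unique reals $p_0,\dots,p_d$ with $p(x)=\sum_{i=0}^d p_i b_i(x)$. Set $p_i=0$ for $i<0$ or $i>d$. For real $t$ write $t_+=\max(0,t)$. Define $$m_i=\frac12\cdot\frac{(i+1)(d-i+1)}{i(d-i)}\quad(1\le i\le d-1),\qquad w_i=\begin{cases}\frac12 & 1<i<d-1\\ 1&\text{otherwise.}\end{cases}$$ $\mathcal{P}_d$ is the set of $p\in\mathbb{R}_d[x]$ with $p(x)\ge 0$ for all $x\in[0,1]$. $\mathcal{NB}_d$ is the set of $p\in\mathbb{R}_d[x]$ all of whose Bernstein coefficients are nonnegative. $\mathcal{GB}_d$ is the set of $p\in\mathbb{R}_d[x]$ such that for every $0\le i\le d$, $$p_i\ \ge\ -\sqrt{\frac{2w_{i-1}w_{i+1}}{m_i}(p_{i-1})_+(p_{i+1})_+},$$ where for $i=0$ and $i=d$ the right-hand side is $0$ (since $p_{-1}=p_{d+1}=0$), so the condition reads $p_0\ge 0$ and $p_d\ge0$. The symbol $\subset$ denotes inclusion (equality allowed). *)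

theory Defs
  imports "HOL-Analysis.Analysis" "HOL-Computational_Algebra.Polynomial"
begin

definition polys_upto :: "nat \<Rightarrow> real poly set" where
  "polys_upto d = {p. degree p \<le> d}"

text \<open>
  Bernstein coefficients are indexed by integers, so that the convention $p_i = 0$ for
  $i < 0$ and $i > d$ is part of the coefficient family. The family is determined by this
  convention and the expansion only if \<^prop>\<open>degree p \<le> d\<close>; see
  \<open>bernstein_coeffs_ex1\<close> below.
\<close>

definition is_bernstein_coeffs :: "nat \<Rightarrow> real poly \<Rightarrow> (int \<Rightarrow> real) \<Rightarrow> bool" where
  "is_bernstein_coeffs d p c \<longleftrightarrow>
     (\<forall>i. i < 0 \<or> int d < i \<longrightarrow> c i = 0) \<and>
     (\<forall>x. poly p x = (\<Sum>i\<le>d. c (int i) * Bernstein d i x))"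

definition bernstein_coeff :: "nat \<Rightarrow> real poly \<Rightarrow> int \<Rightarrow> real" where
  "bernstein_coeff d p = (THE c. is_bernstein_coeffs d p c)"

definition pos_part :: "real \<Rightarrow> real" where
  "pos_part t = max 0 t"

text \<open>
  Only the values of \<open>gb_m d i\<close> for $1 \le i \le d - 1$ are meaningful. For $i = 0$ and
  $i = d$ its denominator vanishes, but then \<open>gb_bound\<close> contains a
  Bernstein coefficient outside the range $0, \dots, d$, and the bound is $0$; see
  \<open>gb_bound_ends\<close> below.
\<close>

definition gb_m :: "nat \<Rightarrow> int \<Rightarrow> real" where
  "gb_m d i = 1 / 2 * (of_int ((i + 1) * (int d - i + 1)) / of_int (i * (int d - i)))"

definition gb_w :: "nat \<Rightarrow> int \<Rightarrow> real" where
  "gb_w d i = (if 1 < i \<and> i < int d - 1 then 1 / 2 else 1)"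

definition gb_bound :: "nat \<Rightarrow> real poly \<Rightarrow> int \<Rightarrow> real" where
  "gb_bound d p i =
     - sqrt (2 * gb_w d (i - 1) * gb_w d (i + 1) / gb_m d i
             * pos_part (bernstein_coeff d p (i - 1)) * pos_part (bernstein_coeff d p (i + 1)))"

definition nonneg_on_unit :: "nat \<Rightarrow> real poly set" where
  "nonneg_on_unit d = {p \<in> polys_upto d. \<forall>x\<in>{0..1}. poly p x \<ge> 0}"

definition NB :: "nat \<Rightarrow> real poly set" where
  "NB d = {p \<in> polys_upto d. \<forall>i\<in>{0..int d}. bernstein_coeff d p i \<ge> 0}"

definition GB :: "nat \<Rightarrow> real poly set" where
  "GB d = {p \<in> polys_upto d. \<forall>i\<in>{0..int d}. bernstein_coeff d p i \<ge> gb_bound d p i}"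

lemma bernstein_coeffs_exist:
  assumes "degree p \<le> d"
  shows "\<exists>c. is_bernstein_coeffs d p c"
proof -
  define a where "a i = (\<Sum>k\<le>i. coeff p k * real ((d - k) choose (i - k))) / real (d choose i)" for i
  define c where "c i = (if i < 0 \<or> int d < i then 0 else a (nat i))" for i :: int
  have mono_exp: "x ^ k = (\<Sum>i\<in>{k..d}. real ((d - k) choose (i - k)) * x ^ i * (1 - x) ^ (d - i))"
    if "k \<le> d" for k and x :: real
  proof -
    have "x ^ k = x ^ k * (x + (1 - x)) ^ (d - k)"
      by simp
    also have "\<dots> = (\<Sum>j\<le>d - k. x ^ k * (real ((d - k) choose j) * x ^ j * (1 - x) ^ (d - k - j)))"
      by (simp only: binomial_ring sum_distrib_left)
    also have "\<dots> = (\<Sum>i\<in>{k..d}. real ((d - k) choose (i - k)) * x ^ i * (1 - x) ^ (d - i))"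
      by (rule sum.reindex_bij_witness[of _ "\<lambda>i. i - k" "\<lambda>j. j + k"])
         (use that in \<open>auto simp: power_add algebra_simps\<close>)
    finally show ?thesis .
  qed
  have "poly p x = (\<Sum>i\<le>d. c (int i) * Bernstein d i x)" for x
  proof -
    have "poly p x = (\<Sum>k\<le>d. coeff p k * x ^ k)"
      using assms coeff_eq_0[of p] by (subst poly_altdef, intro sum.mono_neutral_left) auto
    also have "\<dots> = (\<Sum>k\<le>d. \<Sum>i\<in>{k..d}.
        coeff p k * real ((d - k) choose (i - k)) * (x ^ i * (1 - x) ^ (d - i)))"
      by (rule sum.cong[OF refl], subst mono_exp) (auto simp: sum_distrib_left mult_ac)
    also have "\<dots> = (\<Sum>i\<le>d. \<Sum>k\<le>i.
        coeff p k * real ((d - k) choose (i - k)) * (x ^ i * (1 - x) ^ (d - i)))"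
      by (subst (1 2) sum.Sigma, simp, simp, simp, simp,
          rule sum.reindex_bij_witness[of _ "\<lambda>(i, k). (k, i)" "\<lambda>(k, i). (i, k)"]) auto
    also have "\<dots> = (\<Sum>i\<le>d. c (int i) * Bernstein d i x)"
      by (rule sum.cong) (auto simp: c_def a_def Bernstein_def simp flip: sum_distrib_right)
    finally show ?thesis .
  qed
  then show ?thesis
    unfolding is_bernstein_coeffs_def by (intro exI[of _ c]) (auto simp: c_def)
qed

lemma bernstein_coeffs_unique:
  assumes "is_bernstein_coeffs d p c" "is_bernstein_coeffs d p c'"
  shows "c = c'"
proof -
  define e where "e i = c i - c' i" for i
  define q where "q = (\<Sum>i\<le>d. monom (e (int i) * real (d choose i)) i)"
  have zero: "(\<Sum>i\<le>d. e (int i) * Bernstein d i x) = 0" for x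
    using assms by (simp add: is_bernstein_coeffs_def e_def algebra_simps sum_subtractf)
  have "poly q t = 0" if "t > 0" for t
  proof -
    define x where "x = t / (1 + t)"
    have x: "1 - x = 1 / (1 + t)"
      using that by (simp add: x_def field_simps)
    have "poly q t = (\<Sum>i\<le>d. e (int i) * Bernstein d i x * (1 + t) ^ d)"
      unfolding q_def poly_sum poly_monom
    proof (rule sum.cong[OF refl])
      fix i assume "i \<in> {..d}"
      then have "(1 + t) ^ d = (1 + t) ^ i * (1 + t) ^ (d - i)"
        by (simp flip: power_add)
      then have "x ^ i * (1 - x) ^ (d - i) * (1 + t) ^ d = t ^ i"
        using that unfolding x by (simp add: x_def power_divide)
      then show "e (int i) * real (d choose i) * t ^ i = e (int i) * Bernstein d i x * (1 + t) ^ d"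
        by (simp add: Bernstein_def mult.assoc)
    qed
    also have "\<dots> = 0"
      using zero[of x] by (simp flip: sum_distrib_right)
    finally show ?thesis .
  qed
  then have "{0<..} \<subseteq> {t. poly q t = 0}"
    by auto
  then have "infinite {t. poly q t = 0}"
    using infinite_Ioi[of "0::real"] finite_subset by blast
  then have "q = 0"
    using poly_roots_finite by blast
  moreover have "coeff q i = e (int i) * real (d choose i)" if "i \<le> d" for i
    using that by (simp add: q_def coeff_sum)
  ultimately have e0: "e (int i) = 0" if "i \<le> d" for i
    using that by fastforce
  show ?thesis
  proof
    fix i :: int
    show "c i = c' i"
    proof (cases "i < 0 \<or> int d < i")
      case True
      then show ?thesis using assms by (auto simp: is_bernstein_coeffs_def)
    next
      case False
      then have "nat i \<le> d" "int (nat i) = i" by auto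
      then show ?thesis using e0[of "nat i"] by (simp add: e_def)
    qed
  qed
qed

lemma bernstein_coeffs_ex1: "degree p \<le> d \<Longrightarrow> \<exists>!c. is_bernstein_coeffs d p c"
  using bernstein_coeffs_exist bernstein_coeffs_unique by blast

lemma is_bernstein_coeffs_bernstein_coeff:
  "degree p \<le> d \<Longrightarrow> is_bernstein_coeffs d p (bernstein_coeff d p)"
  unfolding bernstein_coeff_def by (rule theI'[OF bernstein_coeffs_ex1])

lemma gb_bound_ends:
  assumes "degree p \<le> d"
  shows "gb_bound d p 0 = 0" "gb_bound d p (int d) = 0"
  using is_bernstein_coeffs_bernstein_coeff[OF assms]
  by (simp_all add: gb_bound_def is_bernstein_coeffs_def pos_part_def)

end

theory Submission
  imports Defs
begin

text \<open>
  The inclusion of \<^const>\<open>NB\<close> in \<^const>\<open>GB\<close> holds because the bound on each coefficient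
  is nonpositive. The inclusion of \<^const>\<open>GB\<close> in \<^const>\<open>nonneg_on_unit\<close> says that each negative
  term of the Bernstein expansion can be paid for by its two neighbours.

  Write $P_j = (p_j)_+ b_j(x)$ for $x \in [0,1]$. The constant $m_i$ is the one for which
  $b_i^2 = 2 m_i b_{i-1} b_{i+1}$ (\<open>Bernstein_square\<close>). Hence multiplying the
  bound on $p_i$ by $b_i$ gives $p_i b_i \ge -2 \sqrt{w_{i-1} P_{i-1} \cdot w_{i+1} P_{i+1}}$,
  and by the inequality of arithmetic and geometric means a negative term satisfies
  $p_i b_i \ge -(w_{i-1} P_{i-1} + w_{i+1} P_{i+1})$ (\<open>GB_term_lower_bound\<close>).

  The weights make sure that no $P_j$ is spent twice. The terms $0$ and $d$ are nonnegative, so only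
  the indices $0 < i < d$ need payment. If $1 < j < d - 1$, then $P_j$ is asked to pay half
  of itself to each of two neighbours; every other $P_j$ has at most one neighbour
  to pay, and may spend all of itself (\<open>sum_neighbours_le\<close>). Summing over $i$ gives $p(x) \ge 0$.
\<close>

lemma binomial_Suc_ratio: "Suc k * (n choose Suc k) = (n - k) * (n choose k)"
  by (simp only: binomial_absorption binomial_absorb_comp)

lemma gb_m_nonneg: "0 \<le> i \<Longrightarrow> i \<le> int d \<Longrightarrow> 0 \<le> gb_m d i"
  unfolding gb_m_def
  by (intro mult_nonneg_nonneg divide_nonneg_nonneg) (simp_all only: of_int_0_le_iff, auto)

lemma gb_m_pos: "0 < i \<Longrightarrow> i < int d \<Longrightarrow> 0 < gb_m d i"
  unfolding gb_m_def
  by (intro mult_pos_pos divide_pos_pos) (simp_all only: of_int_0_less_iff, auto)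

lemma gb_w_pos: "0 < gb_w d i"
  by (simp add: gb_w_def)

lemma pos_part_nonneg: "0 \<le> pos_part t"
  by (simp add: pos_part_def)

text \<open>
  The powers of $x$ and $1 - x$ agree on both sides, so the identity is one between binomial
  coefficients: $m_i$ measures exactly how strictly log-concave they are.
\<close>

lemma Bernstein_square:
  assumes "0 < i" "i < d"
  shows "(Bernstein d i x)\<^sup>2
    = 2 * gb_m d (int i) * Bernstein d (i - 1) x * Bernstein d (i + 1) x"
proof -
  obtain k where i: "i = Suc k"
    using assms by (cases i) auto
  obtain n where d: "d = k + n + 2"
    using assms(2) i that[of "d - k - 2"] by linarith
  define a b c where "a = real (d choose k)" and "b = real (d choose Suc k)"
    and "c = real (d choose Suc (Suc k))"
  have ab: "(real k + 1) * b = (real n + 2) * a"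
    using arg_cong[OF binomial_Suc_ratio[of k d], of real]
    by (simp add: a_def b_def d algebra_simps)
  have bc: "(real k + 2) * c = (real n + 1) * b"
    using arg_cong[OF binomial_Suc_ratio[of "Suc k" d], of real]
    by (simp add: c_def b_def d algebra_simps)
  have "(real k + 1) * (real n + 1) * b\<^sup>2 = ((real k + 1) * b) * ((real n + 1) * b)"
    by (simp add: power2_eq_square)
  also have "\<dots> = (real k + 2) * (real n + 2) * (a * c)"
    unfolding ab bc[symmetric] by simp
  finally have "b\<^sup>2 = (real k + 2) * (real n + 2) / ((real k + 1) * (real n + 1)) * (a * c)"
    by (simp add: nonzero_eq_divide_eq mult_ac)
  moreover have "2 * gb_m d (int i) = (real k + 2) * (real n + 2) / ((real k + 1) * (real n + 1))"
    by (simp add: gb_m_def i d add_ac)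
  ultimately have sq: "b\<^sup>2 = 2 * gb_m d (int i) * (a * c)"
    by simp
  have diffs: "d - k = n + 2" "d - Suc k = n + 1" "d - Suc (Suc k) = n"
    using d by simp_all
  have B: "Bernstein d (i - 1) x = a * x ^ k * (1 - x) ^ (n + 2)"
    "Bernstein d i x = b * x ^ (k + 1) * (1 - x) ^ (n + 1)"
    "Bernstein d (i + 1) x = c * x ^ (k + 2) * (1 - x) ^ n"
    by (simp_all only: Bernstein_def a_def b_def c_def i diff_Suc_1 diffs flip: Suc_eq_plus1)
      simp_all
  have "(Bernstein d i x)\<^sup>2 = b\<^sup>2 * (x ^ k * x ^ (k + 2)) * ((1 - x) ^ (n + 2) * (1 - x) ^ n)"
    unfolding B by (simp add: power2_eq_square power_add mult_ac)
  also have "\<dots> = 2 * gb_m d (int i) * Bernstein d (i - 1) x * Bernstein d (i + 1) x"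
    unfolding sq B by (simp only: mult_ac)
  finally show ?thesis .
qed

lemma gb_bound_nonpos: "0 \<le> i \<Longrightarrow> i \<le> int d \<Longrightarrow> gb_bound d p i \<le> 0"
  unfolding gb_bound_def
  by (simp add: gb_m_nonneg gb_w_pos less_imp_le pos_part_nonneg)

lemma NB_subset_GB: "NB d \<subseteq> GB d"
  by (auto simp: NB_def GB_def intro: order_trans[OF gb_bound_nonpos])

text \<open>
  Including $P_i$ on the left makes one inequality serve for both signs of $p_i$, so that it can
  be summed over all $i$ at once: if $p_i \ge 0$, then $P_i = p_i b_i$ and the subtracted terms only
  weaken the bound; if $p_i < 0$, then $P_i = 0$ and the arithmetic-geometric mean argument applies.
\<close>

lemma GB_term_lower_bound:
  fixes d :: nat and p :: "real poly" and x :: real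
  defines "P \<equiv> \<lambda>j. pos_part (bernstein_coeff d p (int j)) * Bernstein d j x"
  assumes i: "0 < i" "i < d" and x: "0 \<le> x" "x \<le> 1"
    and bound: "gb_bound d p (int i) \<le> bernstein_coeff d p (int i)"
  shows "P i - gb_w d (int (i - 1)) * P (i - 1) - gb_w d (int (i + 1)) * P (i + 1)
    \<le> bernstein_coeff d p (int i) * Bernstein d i x"
proof -
  define B where "B = (\<lambda>j. Bernstein d j x)"
  define c where "c = (\<lambda>j. bernstein_coeff d p (int j))"
  define u where "u = gb_w d (int (i - 1)) * P (i - 1)"
  define v where "v = gb_w d (int (i + 1)) * P (i + 1)"
  have B: "0 \<le> B j" for j
    using x by (simp add: B_def Bernstein_nonneg)
  have P: "0 \<le> P j" for j
    using B[of j] by (simp add: P_def B_def pos_part_nonneg)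
  have u: "0 \<le> u" and v: "0 \<le> v"
    using P by (simp_all add: u_def v_def gb_w_pos less_imp_le)
  have "P i - u - v \<le> c i * B i"
  proof (cases "0 \<le> c i")
    case True
    then show ?thesis
      using u v by (simp add: P_def c_def B_def pos_part_def)
  next
    case False
    define r where "r = 2 * gb_w d (int (i - 1)) * gb_w d (int (i + 1)) / gb_m d (int i)
      * pos_part (c (i - 1)) * pos_part (c (i + 1))"
    have m: "0 < gb_m d (int i)"
      using gb_m_pos i by simp
    \<comment> \<open>Multiplying by $b_i^2$ cancels $m_i$ and turns the radicand into a product of payments.\<close>
    have "r * (B i)\<^sup>2 = 4 * (u * v)"
      using Bernstein_square[OF i, of x] m
      by (simp add: r_def u_def v_def P_def B_def c_def)
    moreover have "4 * (u * v) \<le> (u + v)\<^sup>2"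
      using zero_le_power2[of "u - v"] by (simp add: power2_eq_square algebra_simps)
    ultimately have "sqrt (r * (B i)\<^sup>2) \<le> u + v"
      using u v by (intro real_le_lsqrt) auto
    then have "sqrt r * B i \<le> u + v"
      using B[of i] by (simp add: real_sqrt_mult)
    moreover have "gb_bound d p (int i) = - sqrt r"
      using i by (simp add: gb_bound_def r_def c_def add.commute)
    then have "- (sqrt r * B i) \<le> c i * B i"
      using mult_right_mono[OF bound B[of i]] by (simp add: c_def)
    moreover have "P i = 0"
      using False by (simp add: P_def c_def pos_part_def)
    ultimately show ?thesis
      by linarith
  qed
  then show ?thesis
    by (simp add: u_def v_def c_def B_def)
qed

text \<open>
  Regrouped by the paying index $j$, the left-hand side contains $w_j P_j$ once for
  each neighbour of $j$ strictly between $0$ and $d$. Both neighbours lie there precisely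
  when $1 < j < d - 1$, which is where the weight is a half.
\<close>

lemma sum_neighbours_le:
  fixes P :: "nat \<Rightarrow> real"
  assumes P: "\<And>j. 0 \<le> P j"
  shows "(\<Sum>i\<in>{0<..<d}. gb_w d (int (i - 1)) * P (i - 1) + gb_w d (int (i + 1)) * P (i + 1))
    \<le> (\<Sum>j\<le>d. P j)"
proof -
  define f where "f = (\<lambda>j. gb_w d (int j) * P j)"
  have "(\<Sum>i\<in>{0<..<d}. f (i - 1)) = (\<Sum>j\<in>{j. j \<le> d \<and> j + 1 < d}. f j)"
    by (rule sum.reindex_bij_witness[of _ "\<lambda>j. j + 1" "\<lambda>i. i - 1"]) auto
  also have "\<dots> = (\<Sum>j\<le>d. if j + 1 < d then f j else 0)"
    by (rule sum.mono_neutral_cong_left) auto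
  finally have left: "(\<Sum>i\<in>{0<..<d}. f (i - 1)) = (\<Sum>j\<le>d. if j + 1 < d then f j else 0)" .
  have "(\<Sum>i\<in>{0<..<d}. f (i + 1)) = (\<Sum>j\<in>{j. j \<le> d \<and> 1 < j}. f j)"
    by (rule sum.reindex_bij_witness[of _ "\<lambda>j. j - 1" "\<lambda>i. i + 1"]) auto
  also have "\<dots> = (\<Sum>j\<le>d. if 1 < j then f j else 0)"
    by (rule sum.mono_neutral_cong_left) auto
  finally have right: "(\<Sum>i\<in>{0<..<d}. f (i + 1)) = (\<Sum>j\<le>d. if 1 < j then f j else 0)" .
  have "(\<Sum>i\<in>{0<..<d}. f (i - 1) + f (i + 1))
      = (\<Sum>j\<le>d. (if j + 1 < d then f j else 0) + (if 1 < j then f j else 0))"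
    by (simp only: sum.distrib left right)
  also have "\<dots> \<le> (\<Sum>j\<le>d. P j)"
    by (rule sum_mono) (use P in \<open>auto simp: f_def gb_w_def\<close>)
  finally show ?thesis
    by (simp only: f_def)
qed

lemma GB_subset_nonneg_on_unit: "GB d \<subseteq> nonneg_on_unit d"
proof
  fix p assume p: "p \<in> GB d"
  then have deg: "degree p \<le> d"
    and bound: "\<And>i. i \<le> d \<Longrightarrow> gb_bound d p (int i) \<le> bernstein_coeff d p (int i)"
    by (auto simp: GB_def polys_upto_def)
  have "0 \<le> poly p x" if x: "x \<in> {0..1}" for x
  proof -
    define c where "c = (\<lambda>j. bernstein_coeff d p (int j))"
    define P where "P = (\<lambda>j. pos_part (c j) * Bernstein d j x)"
    define S where "S = (\<lambda>i. gb_w d (int (i - 1)) * P (i - 1) + gb_w d (int (i + 1)) * P (i + 1))"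
    have P: "0 \<le> P j" for j
      using x by (simp add: P_def pos_part_nonneg Bernstein_nonneg)
    have ends: "0 \<le> c 0" "0 \<le> c d"
      using bound[of 0] bound[of d] gb_bound_ends[OF deg] by (simp_all add: c_def)
    have "(\<Sum>i\<le>d. if i \<in> {0<..<d} then S i else 0) = (\<Sum>i\<in>{0<..<d}. S i)"
      by (rule sum.mono_neutral_cong_right) auto
    also have "\<dots> \<le> (\<Sum>j\<le>d. P j)"
      unfolding S_def by (rule sum_neighbours_le) (rule P)
    finally have "0 \<le> (\<Sum>i\<le>d. P i - (if i \<in> {0<..<d} then S i else 0))"
      by (simp add: sum_subtractf)
    also have "\<dots> \<le> (\<Sum>i\<le>d. c i * Bernstein d i x)"
    proof (rule sum_mono)
      fix i assume i: "i \<in> {..d}"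
      show "P i - (if i \<in> {0<..<d} then S i else 0) \<le> c i * Bernstein d i x"
      proof (cases "i \<in> {0<..<d}")
        case True
        then show ?thesis
          using GB_term_lower_bound[of i d x p] x bound[of i]
          by (simp add: S_def P_def c_def algebra_simps)
      next
        case False
        then have "i = 0 \<or> i = d"
          using i by auto
        then show ?thesis
          using ends False by (auto simp: P_def pos_part_def)
      qed
    qed
    also have "\<dots> = poly p x"
      using is_bernstein_coeffs_bernstein_coeff[OF deg]
      by (simp add: is_bernstein_coeffs_def c_def)
    finally show ?thesis .
  qed
  then show "p \<in> nonneg_on_unit d"
    using deg by (simp add: nonneg_on_unit_def polys_upto_def)
qed

theorem theorem3:
  fixes d :: nat
  assumes "0 < d"
  shows "NB d \<subseteq> GB d \<and> GB d \<subseteq> nonneg_on_unit d"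
  using NB_subset_GB GB_subset_nonneg_on_unit by blast

end
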